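(* Let $R=K[x_1,\ldots,x_n]$ be a polynomial ring over a field $K$, let $\mathcal H$ be a balanced hypergraph on the vertex set $\{1,\ldots,n\}$, and let $I=J(\mathcal H)$ be its cover ideal in $R$. Then $\operatorname{assrad}(I^{s})\subseteq \operatorname{assrad}(I^{s+1})$ for every integer $s\ge 1$.
   Context: For a monomial ideal $I$ of $R$, $\operatorname{assrad}(I)=\{\sqrt{I:f}\mid f \text{ is a monomial of } R,\ f\notin I\}$ denotes the set of associated radical ideals of $I$. A hypergraph $\mathcal H=(\mathcal V,\mathcal E)$ on $\mathcal V=\{1,\ldots,n\}$ consists of a family $\mathcal E$ of distinct non-empty subsets of $\mathcal V$, called edges. A vertex cover of $\mathcal H$ is a subset of $\mathcal V$ meeting every edge; it is minimal if no proper subset of it is a vertex cover. For $\tau=\{i_1,\ldots,i_t\}\subseteq\mathcal V$ put $\mathbf x_\tau=x_{i_1}\cdots x_{i_t}$. The cover ideal is $J(\mathcal H)=(\mathbf x_\tau\mid \tau \text{ is a minimal vertex cover of }\mathcal H)=\bigcap_{E\in\mathcal E}(x_i\mid i\in E)$. A cycle of length $k\ge 2$ in $\mathcal H$ is a sequence $(i_1,E_1,i_2,E_2,\ldots,i_k,E_k,i_1)$ where $E_1,\ldots,E_k$ are distinct edges, $i_1,\ldots,i_k$ are distinct vertices, $\{i_t,i_{t+1}\}\subseteq E_t$ for $t=1,\ldots,k-1$, and $\{i_k,i_1\}\subseteq E_k$. The hypergraph $\mathcal H$ is balanced if every cycle of odd length has an edge (among $E_1,\ldots,E_k$) containing at least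 three of the vertices $i_1,\ldots,i_k$ of the cycle. Equivalently, the edge-vertex incidence matrix of $\mathcal H$ (the $0$-$1$ matrix with entry $1$ in position $(E,j)$ iff $j\in E$) has, up to permutation of rows and columns, no $k\times k$ submatrix with $k\ge 3$ odd that is the incidence matrix of a cycle graph of length $k$. *)

theory Defs
  imports Complex_Main "HOL-Library.Poly_Mapping"
begin

text \<open>The ideals of a commutative ring are its submodules as a module over itself:
  \<open>ideal.span B\<close> is the ideal generated by \<open>B\<close>.\<close>

interpretation ideal: module "times :: 'a::comm_ring_1 \<Rightarrow> 'a \<Rightarrow> 'a"
  by standard (simp_all add: algebra_simps)

definition ideal_prod :: "'a::comm_ring_1 set \<Rightarrow> 'a set \<Rightarrow> 'a set" where
  "ideal_prod I J = ideal.span {a * b | a b. a \<in> I \<and> b \<in> J}"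

primrec ideal_power :: "'a::comm_ring_1 set \<Rightarrow> nat \<Rightarrow> 'a set" where
  "ideal_power I 0 = UNIV"
| "ideal_power I (Suc s) = ideal_prod I (ideal_power I s)"

definition ideal_colon :: "'a::comm_ring_1 set \<Rightarrow> 'a \<Rightarrow> 'a set" where
  "ideal_colon I f = {g. g * f \<in> I}"

definition ideal_radical :: "'a::comm_ring_1 set \<Rightarrow> 'a set" where
  "ideal_radical I = {g. \<exists>m::nat. g ^ m \<in> I}"

text \<open>The polynomial ring in the variables \<open>x\<^sub>i\<close>, \<open>i :: 'v\<close>, where the finite type \<open>'v\<close>
  plays the role of \<open>{1, \<dots>, n}\<close>: a polynomial maps exponent vectors to coefficients.\<close>

type_synonym ('v, 'k) mpolynomial = "('v \<Rightarrow>\<^sub>0 nat) \<Rightarrow>\<^sub>0 'k"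

definition monomials :: "('v, 'k::field) mpolynomial set" where
  "monomials = range (\<lambda>a. Poly_Mapping.single a 1)"

definition var :: "'v \<Rightarrow> ('v, 'k::field) mpolynomial" where
  "var i = Poly_Mapping.single (Poly_Mapping.single i 1) 1"

definition assrad :: "('v, 'k::field) mpolynomial set \<Rightarrow> ('v, 'k) mpolynomial set set" where
  "assrad I = {ideal_radical (ideal_colon I f) | f. f \<in> monomials \<and> f \<notin> I}"

text \<open>A hypergraph is given by its set of edges; its vertex set is the whole type \<open>'v\<close>.
  Vertices contained in no edge are allowed.\<close>

definition hypergraph :: "'v set set \<Rightarrow> bool" where
  "hypergraph \<E> \<longleftrightarrow> {} \<notin> \<E>"

definition vertex_cover :: "'v set set \<Rightarrow> 'v set \<Rightarrow> bool" where
  "vertex_cover \<E> C \<longleftrightarrow> (\<forall>E\<in>\<E>. C \<inter> E \<noteq> {})"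

definition minimal_vertex_cover :: "'v set set \<Rightarrow> 'v set \<Rightarrow> bool" where
  "minimal_vertex_cover \<E> C \<longleftrightarrow> vertex_cover \<E> C \<and> (\<forall>D. D \<subset> C \<longrightarrow> \<not> vertex_cover \<E> D)"

definition cover_ideal :: "'v set set \<Rightarrow> ('v, 'k::field) mpolynomial set" where
  "cover_ideal \<E> = ideal.span {\<Prod>i\<in>C. var i | C. minimal_vertex_cover \<E> C}"

text \<open>The cycle \<open>(i\<^sub>1, E\<^sub>1, \<dots>, i\<^sub>k, E\<^sub>k, i\<^sub>1)\<close> is encoded by the lists \<open>vs = [i\<^sub>1, \<dots>, i\<^sub>k]\<close>
  and \<open>Es = [E\<^sub>1, \<dots>, E\<^sub>k]\<close>; the index \<open>Suc t mod k\<close> wraps around to \<open>i\<^sub>1\<close> at the end.\<close>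

definition hypergraph_cycle :: "'v set set \<Rightarrow> 'v list \<Rightarrow> 'v set list \<Rightarrow> bool" where
  "hypergraph_cycle \<E> vs Es \<longleftrightarrow>
     length vs \<ge> 2 \<and> length Es = length vs \<and> distinct vs \<and> distinct Es \<and> set Es \<subseteq> \<E> \<and>
     (\<forall>t < length vs. {vs ! t, vs ! (Suc t mod length vs)} \<subseteq> Es ! t)"

definition balanced :: "'v set set \<Rightarrow> bool" where
  "balanced \<E> \<longleftrightarrow>
     (\<forall>vs Es. hypergraph_cycle \<E> vs Es \<and> odd (length vs) \<longrightarrow>
        (\<exists>E\<in>set Es. card (E \<inter> set vs) \<ge> 3))"

end

theory Submission
  imports Defs
begin

text \<open>
  Write \<open>a(E)\<close> for the degree of the monomial \<open>x\<^sup>a\<close> in the variables of an edge \<open>E\<close>, and let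
  \<open>P\<^sub>E = (x\<^sub>i | i \<in> E)\<close>, so that \<open>I\<close> is the intersection of the \<open>P\<^sub>E\<close>. Everything rests on one
  combinatorial fact, due to Berge: in a balanced hypergraph any exponent vector \<open>a\<close> is, for
  every \<open>k \<ge> 1\<close>, a sum of \<open>k\<close> vectors \<open>c\<^sub>0, \<dots>, c\<^bsub>k-1\<^esub>\<close> that share every edge as evenly as
  possible: an edge with \<open>a(E) \<ge> k\<close> has positive degree in each \<open>c\<^sub>i\<close>, and an edge with
  \<open>a(E) \<le> k\<close> has degree at most one in each \<open>c\<^sub>i\<close>
  (\<open>balanced_equitable_decomposition\<close>). The proof redistributes two parts at a time, using a
  two-colouring of the vertices of odd multiplicity in their sum (\<open>balanced_bicolouring\<close>).

  The first property says that a monomial whose degree is at least \<open>s\<close> on every edge is a product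
  of \<open>s\<close> monomials of \<open>I\<close>. Hence \<open>I\<^sup>s\<close> is the symbolic power \<open>\<Inter>\<^sub>E P\<^sub>E\<^sup>s\<close>
  (\<open>balanced_cover_ideal_power_eq_symbolic_power\<close>), and the radical of \<open>I\<^sup>s : x\<^sup>a\<close> is the
  intersection of those \<open>P\<^sub>E\<close> with \<open>a(E) < s\<close>.

  To realise the same radical for \<open>I\<^bsup>s+1\<^esup>\<close>, decompose \<open>a\<close> with \<open>k = s\<close> and replace \<open>a\<close> by
  \<open>a + c\<^sub>0\<close>. Edges with \<open>a(E) \<ge> s\<close> gain at least one, and edges with \<open>a(E) < s\<close> gain at most one.
  So \<open>(a + c\<^sub>0)(E) < s + 1\<close> holds for exactly the same edges as \<open>a(E) < s\<close>
  (\<open>radical_symbolic_colon_eq\<close>).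
\<close>

section \<open>Two-colourings\<close>

text \<open>The form in which balancedness is used: only the traces of the edges on \<open>W\<close> matter, because a
  cycle through vertices of \<open>W\<close> whose traces are its own sides has no edge with a third vertex of
  the cycle. Distinct sides of a polygon with at least three vertices come from distinct edges.\<close>

lemma balanced_no_odd_polygon:
  assumes "balanced \<H>" "distinct zs" "set zs \<subseteq> W" "odd (length zs)" "length zs \<ge> 3"
    and polygon: "\<And>t. t < length zs \<Longrightarrow> \<exists>E\<in>\<H>. E \<inter> W = {zs ! t, zs ! (Suc t mod length zs)}"
  shows False
proof -
  define k where "k = length zs"
  have k: "k \<ge> 3" "k = length zs" using assms k_def by auto
  obtain e where e: "\<And>t. t < k \<Longrightarrow> e t \<in> \<H> \<and> e t \<inter> W = {zs ! t, zs ! (Suc t mod k)}"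
    using polygon unfolding k_def by metis
  have e_inj: "inj_on e {..<k}"
  proof (rule inj_onI)
    fix t u assume tu: "t \<in> {..<k}" "u \<in> {..<k}" "e t = e u"
    have lt: "Suc t mod k < k" "Suc u mod k < k" using k(1) by auto
    have "{zs ! t, zs ! (Suc t mod k)} = {zs ! u, zs ! (Suc u mod k)}"
      using e[of t] e[of u] tu by auto
    then have "zs ! t = zs ! u \<or> (zs ! t = zs ! (Suc u mod k) \<and> zs ! u = zs ! (Suc t mod k))"
      by (auto simp: doubleton_eq_iff)
    then have "t = u \<or> (t = Suc u mod k \<and> u = Suc t mod k)"
      using nth_eq_iff_index_eq[OF assms(2)] tu lt unfolding k_def by auto
    then show "t = u"
      using k(1) tu by (auto simp: mod_Suc split: if_splits)
  qed
  define Es where "Es = map e [0..<k]"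
  have "hypergraph_cycle \<H> zs Es"
    unfolding hypergraph_cycle_def Es_def
    using k e e_inj assms(2) by (fastforce simp: distinct_map atLeast0LessThan)
  then obtain E where E: "E \<in> set Es" "card (E \<inter> set zs) \<ge> 3"
    using \<open>balanced \<H>\<close> \<open>odd (length zs)\<close> unfolding balanced_def by blast
  then obtain t where t: "t < k" "E = e t" by (auto simp: Es_def)
  have "E \<inter> set zs \<subseteq> {zs ! t, zs ! (Suc t mod k)}" using e[of t] t assms(3) by auto
  then have "card (E \<inter> set zs) \<le> card {zs ! t, zs ! (Suc t mod k)}"
    by (intro card_mono) auto
  also have "\<dots> \<le> 2" by (simp add: card_insert_if)
  finally show False using E(2) by simp
qed

text \<open>Berge's theorem that balanced hypergraphs are bicolourable, also after restriction to any
  vertex set. Take a smallest set \<open>W\<close> that fails and join two vertices when they form the trace of an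
  edge. A two-colouring of \<open>W\<close> without a vertex \<open>j\<close> cannot be extended to \<open>j\<close> in either
  colour, so \<open>j\<close> has neighbours of both colours. If \<open>j\<close> is an end of a longest path, these
  neighbours lie on the path, where the colours alternate; the segment between them closes up
  through \<open>j\<close> to a cycle of odd length.\<close>

lemma balanced_bicolouring:
  assumes "balanced \<H>" "finite W"
  shows "\<exists>R. \<forall>E\<in>\<H>. card (E \<inter> W) \<ge> 2 \<longrightarrow> E \<inter> W \<inter> R \<noteq> {} \<and> (E \<inter> W) - R \<noteq> {}"
  using \<open>finite W\<close>
proof (induction W rule: finite_psubset_induct)
  case (psubset W)
  define good where
    "good W R \<longleftrightarrow> (\<forall>E\<in>\<H>. card (E \<inter> W) \<ge> 2 \<longrightarrow> E \<inter> W \<inter> R \<noteq> {} \<and> (E \<inter> W) - R \<noteq> {})" for W R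
  define adj where "adj u w \<longleftrightarrow> u \<noteq> w \<and> (\<exists>E\<in>\<H>. E \<inter> W = {u, w})" for u w
  have adj_sym: "adj u w \<Longrightarrow> adj w u" for u w
    unfolding adj_def by (auto simp: insert_commute)
  have adj_W: "u \<in> W \<and> w \<in> W" if "adj u w" for u w
    using that unfolding adj_def by auto
  show ?case
  proof (rule ccontr)
    assume "\<not> ?thesis"
    then have bad: "\<not> good W R" for R unfolding good_def by blast
    \<comment> \<open>Giving \<open>j\<close> the colour \<open>S\<close> must spoil some edge, and only a trace \<open>{j, w}\<close> with \<open>w\<close> of
      the same colour can be spoilt.\<close>
    have nbr: "\<exists>w. adj j w \<and> (w \<in> R \<longleftrightarrow> S)" if j: "j \<in> W" and R: "good (W - {j}) R" for j R S
    proof -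
      define R' where "R' = (if S then insert j R else R - {j})"
      obtain E where E: "E \<in> \<H>" "card (E \<inter> W) \<ge> 2" "E \<inter> W \<inter> R' = {} \<or> (E \<inter> W) - R' = {}"
        using bad[of R'] unfolding good_def by blast
      have fin: "finite (E \<inter> W)" using psubset.hyps by simp
      have eq: "E \<inter> (W - {j}) = E \<inter> W - {j}" by auto
      have "\<not> card (E \<inter> (W - {j})) \<ge> 2"
      proof
        assume "card (E \<inter> (W - {j})) \<ge> 2"
        then have "E \<inter> (W - {j}) \<inter> R \<noteq> {} \<and> E \<inter> (W - {j}) - R \<noteq> {}"
          using R E(1) unfolding good_def by blast
        then show False using E(3) unfolding R'_def by (auto split: if_splits)
      qed
      then have jE: "j \<in> E" and "card (E \<inter> W - {j}) = 1"
        using E(2) fin j unfolding eq by (cases "j \<in> E"; simp)+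
      then obtain w where w: "E \<inter> W - {j} = {w}" by (auto simp: card_1_singleton_iff)
      then have EW: "E \<inter> W = {j, w}" "w \<noteq> j" using jE j by auto
      then have "adj j w" using E(1) unfolding adj_def by auto
      moreover have "w \<in> R \<longleftrightarrow> S" using E(3) EW unfolding R'_def by (auto split: if_splits)
      ultimately show ?thesis by blast
    qed
    have "W \<noteq> {}" using bad[of "{}"] unfolding good_def by auto
    then obtain x where x: "x \<in> W" by auto
    define path where
      "path xs \<longleftrightarrow> xs \<noteq> [] \<and> distinct xs \<and> set xs \<subseteq> W \<and> successively adj xs" for xs
    have "path [x]" using x unfolding path_def by simp
    moreover have "length xs \<le> card W" if "path xs" for xs
      using that card_mono[OF psubset.hyps, of "set xs"] distinct_card[of xs]
      unfolding path_def by simp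
    ultimately have "\<exists>xs. path xs \<and> (\<forall>ys. path ys \<longrightarrow> length ys \<le> length xs)"
      by (intro ex_has_greatest_nat[where b = "Suc (card W)"]) (auto simp: less_Suc_eq_le)
    then obtain xs where xs: "path xs" and longest: "\<And>ys. path ys \<Longrightarrow> length ys \<le> length xs"
      by blast
    obtain j ys where jys: "xs = j # ys" using xs unfolding path_def by (cases xs) auto
    have j: "j \<in> W" and j_ys: "j \<notin> set ys" and ys: "distinct ys" "set ys \<subseteq> W" "successively adj ys"
      using xs unfolding path_def jys by (auto simp: successively_Cons)
    have in_ys: "w \<in> set ys" if "adj j w" for w
    proof (rule ccontr)
      assume "w \<notin> set ys"
      then have "path (w # xs)"
        using xs that adj_sym[OF that] adj_W[OF that] unfolding path_def jys adj_def by auto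
      then show False using longest by fastforce
    qed
    have "W - {j} \<subset> W" using j by auto
    then obtain R where R: "good (W - {j}) R" using psubset.IH unfolding good_def by blast
    have alternate: "(u \<in> R) \<noteq> (w \<in> R)" if uw: "adj u w" "u \<noteq> j" "w \<noteq> j" for u w
    proof -
      obtain E where E: "E \<in> \<H>" "E \<inter> W = {u, w}" "u \<noteq> w" using uw(1) unfolding adj_def by auto
      then have "E \<inter> (W - {j}) = {u, w}" using uw by auto
      then show ?thesis using R E unfolding good_def by fastforce
    qed
    have ys_adj: "adj (ys ! i) (ys ! Suc i)" if "Suc i < length ys" for i
      using ys(3) that by (simp add: successively_conv_nth)
    have parity: "(ys ! (i + d) \<in> R \<longleftrightarrow> ys ! i \<in> R) \<longleftrightarrow> even d" if "i + d < length ys" for i d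
      using that
    proof (induction d)
      case (Suc d)
      have "ys ! (i + d) \<noteq> j" "ys ! Suc (i + d) \<noteq> j"
        using j_ys Suc.prems nth_mem[of _ ys] by (auto simp del: nth_mem)
      then have "(ys ! (i + d) \<in> R) \<noteq> (ys ! Suc (i + d) \<in> R)"
        using alternate[OF ys_adj] Suc.prems by simp
      then show ?case using Suc by auto
    qed simp
    obtain r b where rb: "adj j r" "r \<in> R" "adj j b" "b \<notin> R"
      using nbr[OF j R, of True] nbr[OF j R, of False] by auto
    obtain p' q' where pq': "p' < length ys" "ys ! p' = r" "q' < length ys" "ys ! q' = b"
      using in_ys rb by (metis in_set_conv_nth)
    define p q where "p = min p' q'" and "q = max p' q'"
    have pq: "p \<le> q" "q < length ys" "adj j (ys ! p)" "adj j (ys ! q)"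
        "(ys ! p \<in> R) \<noteq> (ys ! q \<in> R)"
      unfolding p_def q_def using pq' rb by (auto simp: min_def max_def)
    have odd_pq: "odd (q - p)" using parity[of p "q - p"] pq by auto
    define zs where "zs = j # take (Suc (q - p)) (drop p ys)"
    have len: "length zs = q - p + 2" unfolding zs_def using pq by simp
    have zs_Suc: "zs ! Suc i = ys ! (p + i)" if "i \<le> q - p" for i
      using that pq unfolding zs_def by simp
    have zs_adj: "adj (zs ! t) (zs ! (Suc t mod length zs))" if t: "t < length zs" for t
    proof (cases t)
      case 0
      then show ?thesis using zs_Suc[of 0] pq len by (simp add: zs_def)
    next
      case (Suc i)
      show ?thesis
      proof (cases "i = q - p")
        case True
        then have "zs ! t = ys ! q" "Suc t mod length zs = 0"
          using Suc zs_Suc[of i] pq len by auto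
        then show ?thesis using adj_sym[OF pq(4)] by (simp add: zs_def)
      next
        case False
        then have "i < q - p" using t Suc len by simp
        then have "zs ! t = ys ! (p + i)" "Suc t mod length zs = Suc t"
            "zs ! Suc t = ys ! Suc (p + i)"
          using Suc zs_Suc[of i] zs_Suc[of "Suc i"] len by auto
        then show ?thesis using ys_adj[of "p + i"] \<open>i < q - p\<close> pq(2) by simp
      qed
    qed
    show False
    proof (rule balanced_no_odd_polygon[OF \<open>balanced \<H>\<close>])
      show "distinct zs" using ys(1) j_ys unfolding zs_def
        by (auto dest: in_set_takeD in_set_dropD)
      show "set zs \<subseteq> W" using ys(2) j unfolding zs_def
        by (auto dest!: in_set_takeD in_set_dropD)
      show "odd (length zs)" using odd_pq len by simp
      show "length zs \<ge> 3" using odd_pq len by (cases "q - p") auto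
      show "\<exists>E\<in>\<H>. E \<inter> W = {zs ! t, zs ! (Suc t mod length zs)}" if "t < length zs" for t
        using zs_adj[OF that] unfolding adj_def by blast
    qed
  qed
qed

section \<open>Equitable decompositions of exponent vectors\<close>

text \<open>Multiplicities reduce to a two-colouring: halve \<open>m\<close>, and let the two-colouring of the
  vertices of odd multiplicity decide which half receives the remaining unit. A vertex of multiplicity
  at least two serves both halves; an edge without such a vertex sees \<open>m\<close> as the indicator function
  of the odd vertices.\<close>

lemma balanced_rebalance_pair:
  fixes m :: "'v::finite \<Rightarrow> nat"
  assumes "balanced \<H>"
  shows "\<exists>f g. (\<forall>v. f v + g v = m v) \<and>
    (\<forall>E\<in>\<H>. sum m E \<ge> 2 \<longrightarrow> sum f E \<ge> 1 \<and> sum g E \<ge> 1)"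
proof -
  define W where "W = {v. odd (m v)}"
  obtain R where R: "\<And>E. E \<in> \<H> \<Longrightarrow> card (E \<inter> W) \<ge> 2 \<Longrightarrow> E \<inter> W \<inter> R \<noteq> {} \<and> (E \<inter> W) - R \<noteq> {}"
    using balanced_bicolouring[OF assms finite[of W]] by blast
  define f where "f v = m v div 2 + of_bool (v \<in> W \<and> v \<in> R)" for v
  define g where "g v = m v div 2 + of_bool (v \<in> W \<and> v \<notin> R)" for v
  have pos: "sum h E \<ge> 1" if "v \<in> E" "h v \<ge> 1" for h :: "'v \<Rightarrow> nat" and v E
    using that member_le_sum[of v E h] by simp
  have "f v + g v = m v" for v
    unfolding f_def g_def W_def by (cases "v \<in> R"; cases "even (m v)"; simp; presburger)
  moreover have "sum f E \<ge> 1 \<and> sum g E \<ge> 1" if E: "E \<in> \<H>" "sum m E \<ge> 2" for E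
  proof (cases "\<exists>v\<in>E. m v \<ge> 2")
    case True
    then obtain v where "v \<in> E" "m v div 2 \<ge> 1" by auto
    then show ?thesis using pos[of v E f] pos[of v E g] unfolding f_def g_def by simp
  next
    case False
    then have m: "m v = of_bool (v \<in> W)" if "v \<in> E" for v
      using that unfolding W_def by (cases "m v = 0"; cases "m v = 1") force+
    have "sum m E = card (E \<inter> W)"
      using m by (simp add: of_bool_def sum.If_cases)
    then obtain u w where "u \<in> E" "u \<in> W" "u \<in> R" "w \<in> E" "w \<in> W" "w \<notin> R"
      using R[OF E(1)] E(2) by auto
    then show ?thesis using pos[of u E f] pos[of w E g] unfolding f_def g_def by simp
  qed
  ultimately show ?thesis by blast
qed

text \<open>The sum on the right counts the parts that meet \<open>E\<close>. The bound is attained only if either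
  all \<open>k\<close> parts meet \<open>E\<close> or no part has degree above one on \<open>E\<close>, so it encodes both halves of
  equitability at once. A decomposition that maximises the total count over all edges works: if an
  edge misses part \<open>p\<close> while part \<open>q\<close> has degree at least two on it, then rebalancing \<open>p\<close>
  against \<open>q\<close> lowers no count and raises the count of this edge.\<close>

lemma balanced_equitable_decomposition:
  fixes a :: "'v::finite \<Rightarrow> nat"
  assumes "balanced \<H>" "k \<ge> 1"
  shows "\<exists>c. (\<forall>v. (\<Sum>i<k. c i v) = a v) \<and>
    (\<forall>E\<in>\<H>. min k (sum a E) \<le> (\<Sum>i<k. min 1 (sum (c i) E)))"
proof -
  define decomp where "decomp c \<longleftrightarrow> (\<forall>v. (\<Sum>i<k. c i v) = a v)" for c :: "nat \<Rightarrow> 'v \<Rightarrow> nat"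
  define N where "N c E = (\<Sum>i<k. min 1 (sum (c i) E))" for c :: "nat \<Rightarrow> 'v \<Rightarrow> nat" and E
  have "decomp (\<lambda>i v. if i = 0 then a v else 0)"
    unfolding decomp_def using assms(2) by (simp add: sum.delta)
  moreover have "(\<Sum>E\<in>\<H>. N c E) \<le> (\<Sum>E\<in>\<H>. k)" for c
  proof (rule sum_mono)
    show "N c E \<le> k" for E unfolding N_def
      using sum_bounded_above[of "{..<k}" "\<lambda>i. min 1 (sum (c i) E)" 1] by simp
  qed
  ultimately have "\<exists>c. decomp c \<and> (\<forall>d. decomp d \<longrightarrow> (\<Sum>E\<in>\<H>. N d E) \<le> (\<Sum>E\<in>\<H>. N c E))"
    by (intro ex_has_greatest_nat[where b = "Suc (\<Sum>E\<in>\<H>. k)"]) (auto simp: less_Suc_eq_le)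
  then obtain c where c: "decomp c"
    and max: "\<And>d. decomp d \<Longrightarrow> (\<Sum>E\<in>\<H>. N d E) \<le> (\<Sum>E\<in>\<H>. N c E)"
    by blast
  have "min k (sum a E\<^sub>0) \<le> N c E\<^sub>0" if E\<^sub>0: "E\<^sub>0 \<in> \<H>" for E\<^sub>0
  proof (rule ccontr)
    assume "\<not> ?thesis"
    then have few: "N c E\<^sub>0 < k" "N c E\<^sub>0 < sum a E\<^sub>0" by auto
    have "\<exists>p<k. sum (c p) E\<^sub>0 = 0"
    proof (rule ccontr)
      assume *: "\<not> ?thesis"
      have "N c E\<^sub>0 = (\<Sum>i<k. 1)" unfolding N_def
        by (rule sum.cong) (use * in \<open>auto simp: min_def Suc_le_eq simp flip: neq0_conv\<close>)
      then show False using few by simp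
    qed
    then obtain p where p: "p < k" "sum (c p) E\<^sub>0 = 0" by blast
    have "\<exists>q<k. sum (c q) E\<^sub>0 \<ge> 2"
    proof (rule ccontr)
      assume *: "\<not> ?thesis"
      have "N c E\<^sub>0 = (\<Sum>i<k. sum (c i) E\<^sub>0)" unfolding N_def
        by (rule sum.cong) (use * in \<open>auto simp: min_def not_le\<close>)
      also have "\<dots> = (\<Sum>v\<in>E\<^sub>0. \<Sum>i<k. c i v)" by (rule sum.swap)
      also have "\<dots> = sum a E\<^sub>0" using c unfolding decomp_def by simp
      finally show False using few by simp
    qed
    then obtain q where q: "q < k" "sum (c q) E\<^sub>0 \<ge> 2" by blast
    have "p \<noteq> q" using p q by auto
    have split_pq: "(\<Sum>i<k. h i) = h p + h q + (\<Sum>i\<in>{..<k} - {p, q}. h i)" for h :: "nat \<Rightarrow> nat"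
    proof -
      have "(\<Sum>i<k. h i) = (\<Sum>i\<in>{..<k} - {p, q}. h i) + (\<Sum>i\<in>{p, q}. h i)"
        using p q by (intro sum.subset_diff) auto
      then show ?thesis using \<open>p \<noteq> q\<close> by simp
    qed
    obtain f g where fg: "\<And>v. f v + g v = c p v + c q v"
      and fg_pos: "\<And>E. E \<in> \<H> \<Longrightarrow> sum (\<lambda>v. c p v + c q v) E \<ge> 2 \<Longrightarrow> sum f E \<ge> 1 \<and> sum g E \<ge> 1"
      using balanced_rebalance_pair[OF assms(1), of "\<lambda>v. c p v + c q v"] by blast
    define d where "d = c(p := f, q := g)"
    have d: "d p = f" "d q = g" "\<And>i. i \<in> {..<k} - {p, q} \<Longrightarrow> d i = c i"
      unfolding d_def using \<open>p \<noteq> q\<close> by auto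
    have "decomp d"
      unfolding decomp_def
    proof
      fix v
      have "(\<Sum>i<k. d i v) = (\<Sum>i<k. c i v)"
        unfolding split_pq[of "\<lambda>i. d i v"] split_pq[of "\<lambda>i. c i v"] using d fg[of v] by simp
      then show "(\<Sum>i<k. d i v) = a v" using c unfolding decomp_def by simp
    qed
    define rest where "rest E = (\<Sum>i\<in>{..<k} - {p, q}. min 1 (sum (c i) E))" for E
    have N_c: "N c E = min 1 (sum (c p) E) + min 1 (sum (c q) E) + rest E"
      and N_d: "N d E = min 1 (sum f E) + min 1 (sum g E) + rest E" for E
      unfolding N_def rest_def
        split_pq[of "\<lambda>i. min 1 (sum (c i) E)"] split_pq[of "\<lambda>i. min 1 (sum (d i) E)"]
      using d by simp_all
    have sums: "sum f E + sum g E = sum (c p) E + sum (c q) E" for E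
      using fg by (simp flip: sum.distrib)
    have pos: "sum f E \<ge> 1 \<and> sum g E \<ge> 1" if "E \<in> \<H>" "sum (c p) E + sum (c q) E \<ge> 2" for E
      using fg_pos[OF that(1)] that(2) by (simp add: sum.distrib)
    have "N c E \<le> N d E" if "E \<in> \<H>" for E
      unfolding N_c N_d using pos[OF that] sums[of E] by linarith
    moreover have "N c E\<^sub>0 < N d E\<^sub>0"
      unfolding N_c N_d using pos[OF E\<^sub>0] p q by auto
    ultimately have "(\<Sum>E\<in>\<H>. N c E) < (\<Sum>E\<in>\<H>. N d E)"
      using E\<^sub>0 by (intro sum_strict_mono_ex1) auto
    then show False using max[OF \<open>decomp d\<close>] by simp
  qed
  then show ?thesis using c unfolding decomp_def N_def by blast
qed

text \<open>Any single part of an equitable decomposition can be split off. On an edge of degree at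
  least \<open>k\<close> each of the other \<open>k - 1\<close> parts keeps degree at least one, so that the remainder is
  again large enough for an induction on \<open>k\<close>.\<close>

lemma balanced_split_off_cover:
  fixes a :: "'v::finite \<Rightarrow> nat"
  assumes "balanced \<H>" "k \<ge> 1"
  shows "\<exists>c. (\<forall>v. c v \<le> a v) \<and> (\<forall>E\<in>\<H>.
    (k \<le> sum a E \<longrightarrow> 1 \<le> sum c E \<and> sum c E + (k - 1) \<le> sum a E) \<and>
    (sum a E \<le> k \<longrightarrow> sum c E \<le> 1))"
proof -
  obtain c where c: "\<And>v. (\<Sum>i<k. c i v) = a v"
    and equitable: "\<And>E. E \<in> \<H> \<Longrightarrow> min k (sum a E) \<le> (\<Sum>i<k. min 1 (sum (c i) E))"
    using balanced_equitable_decomposition[OF assms, of a] by blast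
  have zero: "0 \<in> {..<k}" using assms(2) by simp
  have split0: "(\<Sum>i<k. h i) = h 0 + (\<Sum>i\<in>{..<k} - {0}. h i)" for h :: "nat \<Rightarrow> nat"
    using zero by (simp add: sum.remove)
  have rest: "(\<Sum>i\<in>{..<k} - {0}. min 1 (h i)) \<le> (k - 1)" for h :: "nat \<Rightarrow> nat"
    using sum_bounded_above[of "{..<k} - {0}" "\<lambda>i. min 1 (h i)" 1] zero by simp
  have "c 0 v \<le> a v" for v using split0[of "\<lambda>i. c i v"] c[of v] by simp
  moreover have "(k \<le> sum a E \<longrightarrow> 1 \<le> sum (c 0) E \<and> sum (c 0) E + (k - 1) \<le> sum a E) \<and>
      (sum a E \<le> k \<longrightarrow> sum (c 0) E \<le> 1)" if E: "E \<in> \<H>" for E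
  proof -
    have "sum a E = (\<Sum>i<k. sum (c i) E)" using c by (subst sum.swap) simp
    then have a: "sum a E = sum (c 0) E + (\<Sum>i\<in>{..<k} - {0}. sum (c i) E)"
      using split0 by simp
    have le: "(\<Sum>i\<in>{..<k} - {0}. min 1 (sum (c i) E)) \<le> (\<Sum>i\<in>{..<k} - {0}. sum (c i) E)"
      by (rule sum_mono) simp
    have "min k (sum a E) \<le> min 1 (sum (c 0) E) + (\<Sum>i\<in>{..<k} - {0}. min 1 (sum (c i) E))"
      using equitable[OF E] split0[of "\<lambda>i. min 1 (sum (c i) E)"] by simp
    then show ?thesis using a le rest[of "\<lambda>i. sum (c i) E"] assms(2) by (auto simp: min_def split: if_splits)
  qed
  ultimately show ?thesis by blast
qed

section \<open>Powers of the cover ideal\<close>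

definition edge_degree :: "'v set \<Rightarrow> ('v::finite \<Rightarrow>\<^sub>0 nat) \<Rightarrow> nat" where
  "edge_degree E a = (\<Sum>i\<in>E. Poly_Mapping.lookup a i)"

lemma edge_degree_zero [simp]: "edge_degree E 0 = 0"
  by (simp add: edge_degree_def)

lemma edge_degree_add [simp]: "edge_degree E (a + b) = edge_degree E a + edge_degree E b"
  by (simp add: edge_degree_def lookup_add sum.distrib)

lemma exponent_split_off_cover:
  fixes a :: "'v::finite \<Rightarrow>\<^sub>0 nat"
  assumes "balanced \<H>" "k \<ge> 1"
  shows "\<exists>c d. a = c + d \<and> (\<forall>E\<in>\<H>.
    (k \<le> edge_degree E a \<longrightarrow> 1 \<le> edge_degree E c \<and> k - 1 \<le> edge_degree E d) \<and>
    (edge_degree E a \<le> k \<longrightarrow> edge_degree E c \<le> 1))"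
proof -
  obtain c where c: "\<And>v. c v \<le> Poly_Mapping.lookup a v"
    and split: "\<And>E. E \<in> \<H> \<Longrightarrow>
      (k \<le> sum (Poly_Mapping.lookup a) E \<longrightarrow>
        1 \<le> sum c E \<and> sum c E + (k - 1) \<le> sum (Poly_Mapping.lookup a) E) \<and>
      (sum (Poly_Mapping.lookup a) E \<le> k \<longrightarrow> sum c E \<le> 1)"
    using balanced_split_off_cover[OF assms, of "Poly_Mapping.lookup a"] by blast
  define c' where "c' = Abs_poly_mapping c"
  define d where "d = Abs_poly_mapping (\<lambda>v. Poly_Mapping.lookup a v - c v)"
  have lookup: "Poly_Mapping.lookup c' = c" "Poly_Mapping.lookup d = (\<lambda>v. Poly_Mapping.lookup a v - c v)"
    unfolding c'_def d_def by (simp_all add: lookup_Abs_poly_mapping)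
  have a: "a = c' + d" by (rule poly_mapping_eqI) (simp add: lookup_add lookup c)
  have deg: "edge_degree E a = edge_degree E c' + edge_degree E d" for E unfolding a by simp
  have sums: "sum (Poly_Mapping.lookup a) E = edge_degree E a" "sum c E = edge_degree E c'" for E
    by (simp_all add: edge_degree_def lookup)
  show ?thesis
    by (intro exI[of _ c'] exI[of _ d] conjI a) (use split deg in \<open>auto simp: sums\<close>)
qed

text \<open>The intersection of the powers \<open>P\<^sub>E\<^sup>s\<close> of the monomial primes \<open>P\<^sub>E = (x\<^sub>i | i \<in> E)\<close>, described
  by exponents: a monomial lies in \<open>P\<^sub>E\<^sup>s\<close> iff its degree in the variables of \<open>E\<close> is at least \<open>s\<close>.\<close>

definition symbolic_power :: "'v::finite set set \<Rightarrow> nat \<Rightarrow> ('v, 'k::field) mpolynomial set" where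
  "symbolic_power \<H> s = {p. \<forall>a\<in>Poly_Mapping.keys p. \<forall>E\<in>\<H>. s \<le> edge_degree E a}"

lemma symbolic_power_mult:
  assumes "p \<in> symbolic_power \<H> s" "q \<in> symbolic_power \<H> t"
  shows "p * q \<in> symbolic_power \<H> (s + t)"
  using assms keys_mult[of p q] unfolding symbolic_power_def by (fastforce intro: add_mono)

lemma symbolic_power_zero: "symbolic_power \<H> 0 = UNIV"
  by (simp add: symbolic_power_def)

lemma subspace_symbolic_power: "ideal.subspace (symbolic_power \<H> s)"
proof (rule ideal.subspaceI)
  show "0 \<in> symbolic_power \<H> s" by (simp add: symbolic_power_def)
  show "p + q \<in> symbolic_power \<H> s" if "p \<in> symbolic_power \<H> s" "q \<in> symbolic_power \<H> s"
    for p q :: "('a, 'b) mpolynomial"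
    using that keys_add[of p q] unfolding symbolic_power_def by blast
  show "c * p \<in> symbolic_power \<H> s" if "p \<in> symbolic_power \<H> s" for c p :: "('a, 'b) mpolynomial"
    using symbolic_power_mult[of c \<H> 0 p s] that by (simp add: symbolic_power_zero)
qed

lemma poly_mapping_eq_sum_single:
  "p = (\<Sum>a\<in>Poly_Mapping.keys p. Poly_Mapping.single a (Poly_Mapping.lookup p a))"
proof (rule poly_mapping_eqI)
  fix b
  show "Poly_Mapping.lookup p b = Poly_Mapping.lookup
      (\<Sum>a\<in>Poly_Mapping.keys p. Poly_Mapping.single a (Poly_Mapping.lookup p a)) b"
    by (cases "b \<in> Poly_Mapping.keys p")
      (auto simp: lookup_sum lookup_single when_def in_keys_iff sum.delta')
qed

lemma lookup_mult_monomial: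
  fixes g :: "('v, 'k::field) mpolynomial"
  shows "Poly_Mapping.lookup (g * Poly_Mapping.single a 1) (b + a) = Poly_Mapping.lookup g b"
proof -
  have "g * Poly_Mapping.single a 1 =
      (\<Sum>c\<in>Poly_Mapping.keys g. Poly_Mapping.single (c + a) (Poly_Mapping.lookup g c))"
    by (subst poly_mapping_eq_sum_single[of g]) (simp add: sum_distrib_right mult_single)
  then show ?thesis
    by (cases "b \<in> Poly_Mapping.keys g")
      (auto simp: lookup_sum lookup_single when_def in_keys_iff sum.delta')
qed

lemma keys_mult_monomial:
  fixes g :: "('v, 'k::field) mpolynomial"
  shows "Poly_Mapping.keys (g * Poly_Mapping.single a 1) = (\<lambda>b. b + a) ` Poly_Mapping.keys g"
proof
  show "Poly_Mapping.keys (g * Poly_Mapping.single a 1) \<subseteq> (\<lambda>b. b + a) ` Poly_Mapping.keys g"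
    using keys_mult[of g "Poly_Mapping.single a 1"] by auto
  show "(\<lambda>b. b + a) ` Poly_Mapping.keys g \<subseteq> Poly_Mapping.keys (g * Poly_Mapping.single a 1)"
    by (auto simp: in_keys_iff lookup_mult_monomial)
qed

definition squarefree_exponent :: "'v::finite set \<Rightarrow> ('v \<Rightarrow>\<^sub>0 nat)" where
  "squarefree_exponent C = (\<Sum>i\<in>C. Poly_Mapping.single i 1)"

lemma lookup_squarefree_exponent: "Poly_Mapping.lookup (squarefree_exponent C) i = of_bool (i \<in> C)"
  unfolding squarefree_exponent_def
  by (simp add: lookup_sum lookup_single when_def of_bool_def)

lemma edge_degree_squarefree_exponent: "edge_degree E (squarefree_exponent C) = card (C \<inter> E)"
  unfolding edge_degree_def lookup_squarefree_exponent
  by (simp add: of_bool_def sum.If_cases Int_commute)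

lemma prod_var: "(\<Prod>i\<in>C. var i) = Poly_Mapping.single (squarefree_exponent C) 1"
proof -
  have "finite C" by simp
  then show ?thesis unfolding squarefree_exponent_def
    by (induction C) (simp_all add: var_def mult_single)
qed

lemma cover_ideal_subset_symbolic_power: "cover_ideal \<H> \<subseteq> symbolic_power \<H> 1"
  unfolding cover_ideal_def
proof (rule ideal.span_minimal[OF _ subspace_symbolic_power], safe)
  fix C assume "minimal_vertex_cover \<H> C"
  then have "1 \<le> card (C \<inter> E)" if "E \<in> \<H>" for E
    using that unfolding minimal_vertex_cover_def vertex_cover_def by (simp add: Suc_le_eq card_gt_0_iff)
  then show "(\<Prod>i\<in>C. var i) \<in> symbolic_power \<H> 1"
    by (simp add: symbolic_power_def prod_var edge_degree_squarefree_exponent)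
qed

text \<open>The support of such an exponent vector is a vertex cover, so the monomial is divisible by the
  generator of any minimal vertex cover inside its support.\<close>

lemma monomial_in_cover_ideal:
  assumes "\<And>E. E \<in> \<H> \<Longrightarrow> 1 \<le> edge_degree E a"
  shows "Poly_Mapping.single a x \<in> cover_ideal \<H>"
proof -
  have "vertex_cover \<H> (Poly_Mapping.keys a)"
    unfolding vertex_cover_def
  proof (intro ballI notI)
    fix E assume "E \<in> \<H>" and disj: "Poly_Mapping.keys a \<inter> E = {}"
    then have "edge_degree E a = 0" by (auto simp: edge_degree_def in_keys_iff)
    then show False using assms[OF \<open>E \<in> \<H>\<close>] by simp
  qed
  then obtain C where C: "vertex_cover \<H> C" "C \<subseteq> Poly_Mapping.keys a"
    and C_min: "\<And>D. vertex_cover \<H> D \<Longrightarrow> D \<subseteq> C \<Longrightarrow> C = D"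
    using finite_has_minimal2[of "{C. vertex_cover \<H> C}" "Poly_Mapping.keys a"] by auto
  then have "minimal_vertex_cover \<H> C" unfolding minimal_vertex_cover_def by blast
  then have gen: "(\<Prod>i\<in>C. var i) \<in> cover_ideal \<H>"
    unfolding cover_ideal_def by (intro ideal.span_base) auto
  define b where "b = a - squarefree_exponent C"
  have "b + squarefree_exponent C = a"
  proof (rule poly_mapping_eqI)
    fix i
    have "i \<in> C \<Longrightarrow> Poly_Mapping.lookup a i \<ge> 1" using C(2) by (auto simp: in_keys_iff Suc_le_eq)
    then show "Poly_Mapping.lookup (b + squarefree_exponent C) i = Poly_Mapping.lookup a i"
      by (simp add: b_def lookup_add lookup_minus lookup_squarefree_exponent)
  qed
  then have "Poly_Mapping.single a x = Poly_Mapping.single b x * (\<Prod>i\<in>C. var i)"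
    by (simp add: prod_var mult_single)
  then show ?thesis
    using ideal.span_scale[OF gen[unfolded cover_ideal_def]] by (simp add: cover_ideal_def)
qed

lemma mult_in_ideal_prod: "p \<in> I \<Longrightarrow> q \<in> J \<Longrightarrow> p * q \<in> ideal_prod I J"
  unfolding ideal_prod_def by (intro ideal.span_base) auto

text \<open>Split off one vertex cover after the other.\<close>

lemma balanced_monomial_in_cover_ideal_power:
  fixes x :: "'k::field"
  assumes "balanced \<H>" "\<And>E. E \<in> \<H> \<Longrightarrow> s \<le> edge_degree E a"
  shows "Poly_Mapping.single a x \<in> ideal_power (cover_ideal \<H>) s"
  using assms(2)
proof (induction s arbitrary: a)
  case (Suc s)
  obtain c d where a: "a = c + d"
    and cd: "\<And>E. E \<in> \<H> \<Longrightarrow> Suc s \<le> edge_degree E a \<Longrightarrow> 1 \<le> edge_degree E c \<and> Suc s - 1 \<le> edge_degree E d"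
    using exponent_split_off_cover[OF assms(1), of "Suc s" a] by auto
  have "Poly_Mapping.single c (1::'k) \<in> cover_ideal \<H>"
    by (rule monomial_in_cover_ideal) (use cd Suc.prems in auto)
  moreover have "Poly_Mapping.single d x \<in> ideal_power (cover_ideal \<H>) s"
    by (rule Suc.IH) (use cd Suc.prems in auto)
  ultimately have "Poly_Mapping.single c 1 * Poly_Mapping.single d x \<in> ideal_power (cover_ideal \<H>) (Suc s)"
    by (simp add: mult_in_ideal_prod)
  then show ?case by (simp add: a mult_single)
qed simp

lemma subspace_ideal_power: "ideal.subspace (ideal_power I s)"
  by (cases s) (simp_all add: ideal_prod_def)

text \<open>Balancedness is used for the inclusion from right to left: \<open>P\<^sub>E\<^sup>s\<close> contains \<open>I\<^sup>s\<close> for every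
  hypergraph, but for a triangle the product of the three variables has degree two on each edge and
  does not lie in \<open>I\<^sup>2\<close>.\<close>

theorem balanced_cover_ideal_power_eq_symbolic_power:
  fixes \<H> :: "'v::finite set set"
  assumes "balanced \<H>"
  shows "ideal_power (cover_ideal \<H>) s = (symbolic_power \<H> s :: ('v, 'k::field) mpolynomial set)"
proof
  show "ideal_power (cover_ideal \<H>) s \<subseteq> (symbolic_power \<H> s :: ('v, 'k) mpolynomial set)"
  proof (induction s)
    case (Suc s)
    have "p * q \<in> symbolic_power \<H> (Suc s)"
      if "p \<in> cover_ideal \<H>" "q \<in> ideal_power (cover_ideal \<H>) s"
      for p q :: "('v, 'k) mpolynomial"
      using symbolic_power_mult[of p \<H> 1 q s] that Suc cover_ideal_subset_symbolic_power by auto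
    then show ?case
      unfolding ideal_power.simps ideal_prod_def
      by (intro ideal.span_minimal[OF _ subspace_symbolic_power]) auto
  qed (simp add: symbolic_power_zero)
  show "(symbolic_power \<H> s :: ('v, 'k) mpolynomial set) \<subseteq> ideal_power (cover_ideal \<H>) s"
  proof
    fix p :: "('v, 'k) mpolynomial" assume p: "p \<in> symbolic_power \<H> s"
    show "p \<in> ideal_power (cover_ideal \<H>) s"
      by (subst poly_mapping_eq_sum_single[of p])
        (intro ideal.subspace_sum[OF subspace_ideal_power] balanced_monomial_in_cover_ideal_power[OF assms],
         use p in \<open>auto simp: symbolic_power_def\<close>)
  qed
qed

section \<open>Associated radicals\<close>

lemma symbolic_colon_monomial:
  "g \<in> ideal_colon (symbolic_power \<H> s) (Poly_Mapping.single a 1) \<longleftrightarrow>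
    (\<forall>b\<in>Poly_Mapping.keys g. \<forall>E\<in>\<H>. s \<le> edge_degree E b + edge_degree E a)"
  by (simp add: ideal_colon_def symbolic_power_def keys_mult_monomial)

lemma edge_degree_keys_power:
  fixes g :: "('v::finite, 'k::field) mpolynomial"
  assumes "\<And>b. b \<in> Poly_Mapping.keys g \<Longrightarrow> 1 \<le> edge_degree E b" "b \<in> Poly_Mapping.keys (g ^ m)"
  shows "m \<le> edge_degree E b"
  using assms(2)
proof (induction m arbitrary: b)
  case (Suc m)
  then obtain c d where "b = c + d" "c \<in> Poly_Mapping.keys g" "d \<in> Poly_Mapping.keys (g ^ m)"
    using keys_mult[of g "g ^ m"] by auto
  then show ?case using assms(1)[of c] Suc.IH[of d] by simp
qed simp

text \<open>Both radicals are the intersection of the \<open>P\<^sub>E\<close> with \<open>a(E) < s\<close>, but comparing the colon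
  ideals directly avoids having to know that the \<open>P\<^sub>E\<close> are radical. The colon ideal on the right is
  contained in the one on the left because \<open>c\<close> adds at most one on the edges that impose a condition.
  Conversely, each exponent of an element \<open>g\<close> of the colon ideal on the left has degree at least one
  on those edges, so the exponents of \<open>g\<^bsup>s+1\<^esup>\<close> have degree at least \<open>s + 1\<close> there; the other
  edges impose no condition on the right since \<open>(a + c)(E) \<ge> s + 1\<close>.\<close>

lemma radical_symbolic_colon_eq:
  fixes \<H> :: "'v::finite set set" and a c :: "'v \<Rightarrow>\<^sub>0 nat"
  assumes high: "\<And>E. E \<in> \<H> \<Longrightarrow> s \<le> edge_degree E a \<Longrightarrow> 1 \<le> edge_degree E c"
    and low: "\<And>E. E \<in> \<H> \<Longrightarrow> edge_degree E a < s \<Longrightarrow> edge_degree E c \<le> 1"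
  shows "ideal_radical (ideal_colon (symbolic_power \<H> s) (Poly_Mapping.single a (1::'k::field))) =
    ideal_radical (ideal_colon (symbolic_power \<H> (s + 1)) (Poly_Mapping.single (a + c) 1))"
    (is "ideal_radical ?A = ideal_radical ?B")
proof
  have "g \<in> ?A" if g: "g \<in> ?B" for g
    unfolding symbolic_colon_monomial
  proof (intro ballI)
    fix b E assume "b \<in> Poly_Mapping.keys g" "E \<in> \<H>"
    then have "s + 1 \<le> edge_degree E b + (edge_degree E a + edge_degree E c)"
      using g unfolding symbolic_colon_monomial by auto
    then show "s \<le> edge_degree E b + edge_degree E a" using low[OF \<open>E \<in> \<H>\<close>] by linarith
  qed
  then show "ideal_radical ?B \<subseteq> ideal_radical ?A" unfolding ideal_radical_def by blast
  have "g ^ (s + 1) \<in> ?B" if g: "g \<in> ?A" for g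
    unfolding symbolic_colon_monomial
  proof (intro ballI)
    fix b E assume b: "b \<in> Poly_Mapping.keys (g ^ (s + 1))" and E: "E \<in> \<H>"
    show "s + 1 \<le> edge_degree E b + edge_degree E (a + c)"
    proof (cases "s \<le> edge_degree E a")
      case True
      then show ?thesis using high[OF E] by simp
    next
      case False
      then have "1 \<le> edge_degree E d" if "d \<in> Poly_Mapping.keys g" for d
        using g that E unfolding symbolic_colon_monomial by fastforce
      then have "s + 1 \<le> edge_degree E b" using edge_degree_keys_power[OF _ b] by blast
      then show ?thesis by simp
    qed
  qed
  then have "g ^ (m * (s + 1)) \<in> ?B" if "g ^ m \<in> ?A" for g m
    using that unfolding power_mult by blast
  then show "ideal_radical ?A \<subseteq> ideal_radical ?B" unfolding ideal_radical_def by blast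
qed

theorem theorem4:
  fixes \<H> :: "'v::finite set set"
    and I :: "('v, 'k::field) mpolynomial set"
    and s :: nat
  assumes "hypergraph \<H>"
    and "balanced \<H>"
    and "I = cover_ideal \<H>"
    and "s \<ge> 1"
  shows "assrad (ideal_power I s) \<subseteq> assrad (ideal_power I (s + 1))"
proof
  have power: "ideal_power I t = symbolic_power \<H> t" for t
    using balanced_cover_ideal_power_eq_symbolic_power[OF assms(2)] assms(3) by simp
  fix Q assume "Q \<in> assrad (ideal_power I s)"
  then obtain a where a: "Poly_Mapping.single a (1::'k) \<notin> symbolic_power \<H> s"
    and Q: "Q = ideal_radical (ideal_colon (symbolic_power \<H> s) (Poly_Mapping.single a 1))"
    unfolding assrad_def monomials_def power by auto
  obtain c where c: "\<And>E. E \<in> \<H> \<Longrightarrow> s \<le> edge_degree E a \<Longrightarrow> 1 \<le> edge_degree E c"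
       "\<And>E. E \<in> \<H> \<Longrightarrow> edge_degree E a \<le> s \<Longrightarrow> edge_degree E c \<le> 1"
    using exponent_split_off_cover[OF assms(2,4), of a] by blast
  have "Q = ideal_radical (ideal_colon (symbolic_power \<H> (s + 1)) (Poly_Mapping.single (a + c) 1))"
    unfolding Q by (rule radical_symbolic_colon_eq) (use c in auto)
  moreover obtain E where E: "E \<in> \<H>" "edge_degree E a < s"
    using a by (auto simp: symbolic_power_def not_le)
  then have "Poly_Mapping.single (a + c) 1 \<notin> symbolic_power \<H> (s + 1)"
    using c(2)[OF E(1)] by (auto simp: symbolic_power_def intro!: bexI[of _ E])
  ultimately show "Q \<in> assrad (ideal_power I (s + 1))"
    unfolding assrad_def monomials_def power
    by (intro CollectI exI[of _ "Poly_Mapping.single (a + c) 1"] conjI rangeI)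
qed

end
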